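(* Let $\star$ be a semistar operation on an integral domain $D$ and let $I$ be a nonzero fractional ideal of $D$. Then $I$ is $\star_f$-invertible if and only if $I$ is $\widetilde{\star}$-invertible.
   Context: Let $D$ be an integral domain with quotient field $K$; $\overline{F}(D)$ is the set of nonzero $D$-submodules of $K$. A semistar operation on $D$ is a map $\star:\overline{F}(D)\to\overline{F}(D)$, $E\mapsto E^\star$, such that for all $0\ne x\in K$ and $E,F\in\overline{F}(D)$: $(xE)^\star=xE^\star$; $E\subseteq F$ implies $E^\star\subseteq F^\star$; $E\subseteq E^\star$ and $(E^\star)^\star=E^\star$. The semistar operation of finite type associated to $\star$ is $\star_f$, defined by $E^{\star_f}=\bigcup\{F^\star : F\subseteq E,\ F \text{ a nonzero finitely generated } D\text{-submodule of } K\}$. A nonzero ideal $I\subseteq D$ is a quasi-$\star_f$-ideal if $I^{\star_f}\cap D=I$, and $\mathcal{M}(\star_f)$ denotes the set of maximal elements of the set of proper quasi-$\star_f$-ideals of $D$; these are prime ideals. The semistar operation $\widetilde{\star}$ is defined by $E^{\widetilde{\star}}=\bigcap\{ED_Q : Q\in\mathcal{M}(\star_f)\}$ (an empty intersection being $K$). For $E,F\in\overline{F}(D)$, $(E:F)=\{z\in K: zF\subseteq E\}$, and $I^{-1}=(D:I)$. For a semistar operation $\ast$, a nonzero fractional ideal $I$ of $D$ is $\ast$-invertible if $(II^{-1})^{\ast}=D^{\ast}$. *)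

theory Defs
  imports "HOL-Computational_Algebra.Polynomial_Factorial"
begin

text \<open>
  The domain \<open>D\<close> is the type \<open>'a :: idom\<close> and its quotient field \<open>K\<close> is \<open>'a fract\<close>.
  As usual \<open>D\<close> is identified with its image in \<open>K\<close>, so ideals of \<open>D\<close> are the
  \<open>D\<close>-submodules of \<open>K\<close> contained in \<open>dom_image\<close>.
\<close>

global_interpretation fract_module:
  module "\<lambda>(d :: 'a :: idom) (x :: 'a fract). to_fract d * x"
  by unfold_locales (simp_all add: algebra_simps)

definition dom_image :: "'a :: idom fract set" where
  "dom_image = range to_fract"

definition nonzero_submodules :: "'a :: idom fract set set" where
  "nonzero_submodules = {E. fract_module.subspace E \<and> E \<noteq> {0}}"

definition fin_gen_submodule :: "'a :: idom fract set \<Rightarrow> bool" where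
  "fin_gen_submodule F \<longleftrightarrow> (\<exists>S. finite S \<and> F = fract_module.span S)"

definition nonzero_fractional_ideal :: "'a :: idom fract set \<Rightarrow> bool" where
  "nonzero_fractional_ideal I \<longleftrightarrow>
     I \<in> nonzero_submodules \<and> (\<exists>d. d \<noteq> 0 \<and> (\<lambda>x. to_fract d * x) ` I \<subseteq> dom_image)"

definition nonzero_ideal :: "'a :: idom fract set \<Rightarrow> bool" where
  "nonzero_ideal I \<longleftrightarrow> I \<in> nonzero_submodules \<and> I \<subseteq> dom_image"

definition submodule_prod :: "'a :: idom fract set \<Rightarrow> 'a fract set \<Rightarrow> 'a fract set" where
  "submodule_prod E F = fract_module.span {x * y | x y. x \<in> E \<and> y \<in> F}"

definition submodule_quot :: "'a :: idom fract set \<Rightarrow> 'a fract set \<Rightarrow> 'a fract set" where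
  "submodule_quot E F = {z. \<forall>x\<in>F. z * x \<in> E}"

definition submodule_inv :: "'a :: idom fract set \<Rightarrow> 'a fract set" where
  "submodule_inv I = submodule_quot dom_image I"

text \<open>
  An operation on nonzero submodules is represented by a function on all subsets of \<open>K\<close>;
  its values outside \<open>nonzero_submodules\<close> are unconstrained and irrelevant.
\<close>

definition semistar_operation :: "('a :: idom fract set \<Rightarrow> 'a fract set) \<Rightarrow> bool" where
  "semistar_operation star \<longleftrightarrow>
     (\<forall>E\<in>nonzero_submodules. star E \<in> nonzero_submodules) \<and>
     (\<forall>E\<in>nonzero_submodules. \<forall>x. x \<noteq> 0 \<longrightarrow>
        star ((\<lambda>y. x * y) ` E) = (\<lambda>y. x * y) ` star E) \<and>
     (\<forall>E\<in>nonzero_submodules. \<forall>F\<in>nonzero_submodules. E \<subseteq> F \<longrightarrow> star E \<subseteq> star F) \<and>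
     (\<forall>E\<in>nonzero_submodules. E \<subseteq> star E \<and> star (star E) = star E)"

definition finite_type_star ::
  "('a :: idom fract set \<Rightarrow> 'a fract set) \<Rightarrow> 'a fract set \<Rightarrow> 'a fract set" where
  "finite_type_star star E =
     \<Union> {star F | F. F \<in> nonzero_submodules \<and> fin_gen_submodule F \<and> F \<subseteq> E}"

definition quasi_ideal ::
  "('a :: idom fract set \<Rightarrow> 'a fract set) \<Rightarrow> 'a fract set \<Rightarrow> bool" where
  "quasi_ideal star I \<longleftrightarrow> nonzero_ideal I \<and> star I \<inter> dom_image = I"

definition maximal_quasi_ideals ::
  "('a :: idom fract set \<Rightarrow> 'a fract set) \<Rightarrow> 'a fract set set" where
  "maximal_quasi_ideals star =
     {Q. quasi_ideal star Q \<and> Q \<noteq> dom_image \<and>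
         (\<forall>J. quasi_ideal star J \<and> J \<noteq> dom_image \<and> Q \<subseteq> J \<longrightarrow> J = Q)}"

text \<open>The localization \<open>D\<^sub>Q\<close> inside \<open>K\<close>, meaningful for prime ideals \<open>Q\<close>; the denominators
  are nonzero because \<open>0 \<in> Q\<close>.\<close>

definition localization_at :: "'a :: idom fract set \<Rightarrow> 'a fract set" where
  "localization_at Q = {a / s | a s. a \<in> dom_image \<and> s \<in> dom_image \<and> s \<notin> Q}"

text \<open>If there are no maximal quasi-ideals the intersection below is \<open>\<Inter> {} = UNIV\<close>, that is, \<open>K\<close>.\<close>

definition tilde_star ::
  "('a :: idom fract set \<Rightarrow> 'a fract set) \<Rightarrow> 'a fract set \<Rightarrow> 'a fract set" where
  "tilde_star star E =
     (\<Inter>Q\<in>maximal_quasi_ideals (finite_type_star star). submodule_prod E (localization_at Q))"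

definition star_invertible ::
  "('a :: idom fract set \<Rightarrow> 'a fract set) \<Rightarrow> 'a fract set \<Rightarrow> bool" where
  "star_invertible star I \<longleftrightarrow>
     star (submodule_prod I (submodule_inv I)) = star dom_image"

end

theory Submission
  imports Defs
begin

text \<open>
  Put \<open>J = I I\<^sup>-\<^sup>1\<close>, a nonzero ideal of \<open>D\<close>. Both invertibility conditions say that \<open>J\<close> is
  large, and both turn out to be equivalent to one and the same condition: \<open>J\<close> is contained in
  no maximal quasi-\<open>\<star>\<^sub>f\<close>-ideal.

  On the side of \<open>\<star>\<^sub>f\<close>, the equality \<open>J\<^sup>\<star>\<^sup>f = D\<^sup>\<star>\<^sup>f\<close> just means \<open>1 \<in> J\<^sup>\<star>\<^sup>f\<close>
  (\<open>finite_type_star_eq_dom_iff\<close>). A proper quasi-ideal \<open>Q\<close> has \<open>1 \<notin> Q\<^sup>\<star>\<^sup>f\<close>, so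
  \<open>1 \<in> J\<^sup>\<star>\<^sup>f\<close> prevents \<open>J \<subseteq> Q\<close>. Conversely, \<open>1 \<in> L\<^sup>\<star>\<^sup>f\<close> is witnessed by finitely many
  elements of \<open>L\<close>, so Zorn's lemma applies to the ideals \<open>L\<close> with \<open>1 \<notin> L\<^sup>\<star>\<^sup>f\<close>, and its maximal
  elements are maximal quasi-ideals because \<open>\<star>\<^sub>f\<close> is idempotent
  (\<open>subset_maximal_quasi_ideal\<close>).

  On the side of \<open>\<star>\<^sup>~\<close>, maximal quasi-ideals \<open>Q\<close> are prime
  (\<open>maximal_quasi_ideal_prime\<close>), so that \<open>J D\<^sub>Q\<close> consists of the fractions with numerator in
  \<open>J\<close> and denominator outside \<open>Q\<close>. It follows that \<open>J D\<^sub>Q\<close> is all of \<open>D D\<^sub>Q\<close> when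
  \<open>J\<close> meets the complement of \<open>Q\<close>, and does not contain \<open>1\<close> when \<open>J \<subseteq> Q\<close>
  (\<open>tilde_star_eq_dom_iff\<close>).
\<close>

section \<open>Submodules of the quotient field\<close>

lemma zero_in_dom_image: "0 \<in> dom_image"
  by (auto simp: dom_image_def simp flip: to_fract_0)

lemma one_in_dom_image: "1 \<in> dom_image"
  by (auto simp: dom_image_def simp flip: to_fract_1)

lemma dom_image_mult: "x \<in> dom_image \<Longrightarrow> y \<in> dom_image \<Longrightarrow> x * y \<in> dom_image"
  by (auto simp: dom_image_def simp flip: to_fract_mult)

lemma dom_image_add: "x \<in> dom_image \<Longrightarrow> y \<in> dom_image \<Longrightarrow> x + y \<in> dom_image"
  by (auto simp: dom_image_def simp flip: to_fract_add)

lemma subspace_iff: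
  "fract_module.subspace E \<longleftrightarrow>
     0 \<in> E \<and> (\<forall>x\<in>E. \<forall>y\<in>E. x + y \<in> E) \<and> (\<forall>d\<in>dom_image. \<forall>x\<in>E. d * x \<in> E)"
  unfolding fract_module.subspace_def dom_image_def by auto

lemma subspace_dom_image: "fract_module.subspace dom_image"
  by (simp add: subspace_iff zero_in_dom_image dom_image_add dom_image_mult)

lemma nonzero_submodulesI:
  "fract_module.subspace E \<Longrightarrow> x \<in> E \<Longrightarrow> x \<noteq> 0 \<Longrightarrow> E \<in> nonzero_submodules"
  unfolding nonzero_submodules_def by auto

lemma nonzero_submodulesD: "E \<in> nonzero_submodules \<Longrightarrow> fract_module.subspace E"
  unfolding nonzero_submodules_def by auto

lemma nonzero_submodules_obtain:
  assumes "E \<in> nonzero_submodules"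
  obtains x where "x \<in> E" "x \<noteq> 0"
  using assms unfolding nonzero_submodules_def subspace_iff by blast

lemma dom_image_nonzero_submodule: "dom_image \<in> nonzero_submodules"
  by (rule nonzero_submodulesI[OF subspace_dom_image one_in_dom_image]) simp

lemma dom_image_subset:
  assumes "fract_module.subspace E" "1 \<in> E"
  shows "dom_image \<subseteq> E"
  using assms unfolding subspace_iff by (metis mult.right_neutral subsetI)

lemma subset_submodule_nonzero:
  "E \<in> nonzero_submodules \<Longrightarrow> E \<subseteq> F \<Longrightarrow> fract_module.subspace F \<Longrightarrow> F \<in> nonzero_submodules"
  by (metis nonzero_submodulesI nonzero_submodules_obtain subsetD)

lemma span_nonzero_submodule:
  "x \<in> S \<Longrightarrow> x \<noteq> 0 \<Longrightarrow> fract_module.span S \<in> nonzero_submodules"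
  by (rule nonzero_submodulesI[OF fract_module.subspace_span fract_module.span_base])

text \<open>
  A common denominator \<open>d\<close> of \<open>I\<close> is a nonzero element of \<open>I\<^sup>-\<^sup>1\<close>, which makes the product
  nonzero.
\<close>

lemma submodule_prod_inv_nonzero_ideal:
  assumes "nonzero_fractional_ideal I"
  shows "nonzero_ideal (submodule_prod I (submodule_inv I))"
proof -
  obtain d where I: "I \<in> nonzero_submodules" and "d \<noteq> 0"
    and dI: "(\<lambda>x. to_fract d * x) ` I \<subseteq> dom_image"
    using assms unfolding nonzero_fractional_ideal_def by auto
  obtain x where x: "x \<in> I" "x \<noteq> 0"
    using nonzero_submodules_obtain[OF I] .
  have d: "to_fract d \<in> submodule_inv I"
    using dI unfolding submodule_inv_def submodule_quot_def by auto
  have "submodule_prod I (submodule_inv I) \<in> nonzero_submodules"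
    unfolding submodule_prod_def
    by (rule span_nonzero_submodule[of "x * to_fract d"]) (use x d \<open>d \<noteq> 0\<close> in auto)
  moreover have "submodule_prod I (submodule_inv I) \<subseteq> dom_image"
    unfolding submodule_prod_def
    by (rule fract_module.span_minimal[OF _ subspace_dom_image])
       (auto simp: submodule_inv_def submodule_quot_def mult.commute)
  ultimately show ?thesis
    unfolding nonzero_ideal_def by simp
qed

section \<open>Finite-type semistar operations and their maximal quasi-ideals\<close>

context
  fixes star :: "'a :: idom fract set \<Rightarrow> 'a fract set"
  assumes star: "semistar_operation star"
begin

lemma star_nonzero_submodule: "E \<in> nonzero_submodules \<Longrightarrow> star E \<in> nonzero_submodules"
  using star unfolding semistar_operation_def by simp

lemma star_scale:
  "E \<in> nonzero_submodules \<Longrightarrow> x \<noteq> 0 \<Longrightarrow> star ((\<lambda>y. x * y) ` E) = (\<lambda>y. x * y) ` star E"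
  using star unfolding semistar_operation_def by simp

lemma star_mono:
  "E \<in> nonzero_submodules \<Longrightarrow> F \<in> nonzero_submodules \<Longrightarrow> E \<subseteq> F \<Longrightarrow> star E \<subseteq> star F"
  using star unfolding semistar_operation_def by simp

lemma star_extensive: "E \<in> nonzero_submodules \<Longrightarrow> E \<subseteq> star E"
  using star unfolding semistar_operation_def by simp

lemma star_idem: "E \<in> nonzero_submodules \<Longrightarrow> star (star E) = star E"
  using star unfolding semistar_operation_def by simp

lemma star_subset_star:
  "E \<in> nonzero_submodules \<Longrightarrow> F \<in> nonzero_submodules \<Longrightarrow> E \<subseteq> star F \<Longrightarrow> star E \<subseteq> star F"
  using star_mono[of E "star F"] star_idem[of F] star_nonzero_submodule[of F] by simp

text \<open>
  Finite generating sets can be adjoined to each other and chased through chains, unlike the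
  submodules they span. The nonzero element \<open>x\<close> guarantees that the span is a nonzero submodule,
  where the axioms for \<open>star\<close> apply.
\<close>

lemma finite_type_star_mem_iff:
  assumes "fract_module.subspace E"
  shows "z \<in> finite_type_star star E \<longleftrightarrow>
    (\<exists>S x. finite S \<and> S \<subseteq> E \<and> x \<in> S \<and> x \<noteq> 0 \<and> z \<in> star (fract_module.span S))"
proof
  assume "z \<in> finite_type_star star E"
  then obtain S where S: "finite S" "fract_module.span S \<in> nonzero_submodules"
      "fract_module.span S \<subseteq> E" "z \<in> star (fract_module.span S)"
    unfolding finite_type_star_def fin_gen_submodule_def by auto
  have "\<not> S \<subseteq> {0}"
  proof
    assume "S \<subseteq> {0}"
    then have "fract_module.span S \<subseteq> {0}"
      by (rule fract_module.span_minimal) (rule fract_module.subspace_single_0)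
    then show False
      using S(2) fract_module.span_zero[of S] unfolding nonzero_submodules_def by blast
  qed
  then obtain x where "x \<in> S" "x \<noteq> 0"
    by auto
  moreover have "S \<subseteq> E"
    using S(3) fract_module.span_superset[of S] by simp
  ultimately show "\<exists>S x. finite S \<and> S \<subseteq> E \<and> x \<in> S \<and> x \<noteq> 0 \<and> z \<in> star (fract_module.span S)"
    using S by (intro exI[of _ S] exI[of _ x]) simp
next
  assume "\<exists>S x. finite S \<and> S \<subseteq> E \<and> x \<in> S \<and> x \<noteq> 0 \<and> z \<in> star (fract_module.span S)"
  then obtain S x where S: "finite S" "S \<subseteq> E" "x \<in> S" "x \<noteq> 0" "z \<in> star (fract_module.span S)"
    by auto
  have "fin_gen_submodule (fract_module.span S)"
    unfolding fin_gen_submodule_def using S(1) by auto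
  then show "z \<in> finite_type_star star E"
    unfolding finite_type_star_def
    using S(5) span_nonzero_submodule[OF S(3,4)] fract_module.span_minimal[OF S(2) assms]
    by (intro UnionI[of "star (fract_module.span S)"] CollectI exI[of _ "fract_module.span S"]) simp_all
qed

lemma finite_type_star_mono: "E \<subseteq> F \<Longrightarrow> finite_type_star star E \<subseteq> finite_type_star star F"
  unfolding finite_type_star_def by blast

lemma finite_type_star_extensive:
  assumes "E \<in> nonzero_submodules"
  shows "E \<subseteq> finite_type_star star E"
proof
  fix z assume z: "z \<in> E"
  obtain x where x: "x \<in> E" "x \<noteq> 0"
    using nonzero_submodules_obtain[OF assms] .
  have "z \<in> star (fract_module.span {x, z})"
    using star_extensive[OF span_nonzero_submodule[of x "{x, z}"]] x
      fract_module.span_base[of z "{x, z}"] by auto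
  then show "z \<in> finite_type_star star E"
    unfolding finite_type_star_mem_iff[OF nonzero_submodulesD[OF assms]]
    by (intro exI[of _ "{x, z}"] exI[of _ x]) (use x z in auto)
qed

text \<open>
  The closure \<open>E\<^sup>\<star>\<^sup>f\<close> is the union of a directed family: the finitely many submodules that
  account for the elements of \<open>S\<close> can be merged into one.
\<close>

lemma finite_subset_finite_type_star:
  assumes E: "E \<in> nonzero_submodules" and "finite S" "S \<subseteq> finite_type_star star E"
  shows "\<exists>T x. finite T \<and> T \<subseteq> E \<and> x \<in> T \<and> x \<noteq> 0 \<and> S \<subseteq> star (fract_module.span T)"
  using assms(2,3)
proof (induction S rule: finite_induct)
  case empty
  obtain x where "x \<in> E" "x \<noteq> 0"
    using nonzero_submodules_obtain[OF E] .
  then show ?case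
    by (intro exI[of _ "{x}"] exI[of _ x]) auto
next
  case (insert z S)
  obtain T x where T: "finite T" "T \<subseteq> E" "x \<in> T" "x \<noteq> 0" "S \<subseteq> star (fract_module.span T)"
    using insert by auto
  obtain U y where U: "finite U" "U \<subseteq> E" "y \<in> U" "y \<noteq> 0" "z \<in> star (fract_module.span U)"
    using insert.prems finite_type_star_mem_iff[OF nonzero_submodulesD[OF E]] by auto
  let ?V = "T \<union> U"
  have V: "fract_module.span ?V \<in> nonzero_submodules"
    using span_nonzero_submodule[of x ?V] T by auto
  have "star (fract_module.span T) \<subseteq> star (fract_module.span ?V)"
    by (intro star_mono V span_nonzero_submodule[OF T(3,4)] fract_module.span_mono) simp
  moreover have "star (fract_module.span U) \<subseteq> star (fract_module.span ?V)"
    by (intro star_mono V span_nonzero_submodule[OF U(3,4)] fract_module.span_mono) simp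
  ultimately show ?case
    using T U by (intro exI[of _ ?V] exI[of _ x]) auto
qed

lemma finite_type_star_nonzero_submodule:
  assumes E: "E \<in> nonzero_submodules"
  shows "finite_type_star star E \<in> nonzero_submodules"
proof (rule subset_submodule_nonzero[OF E finite_type_star_extensive[OF E]])
  have common: "\<exists>A. fract_module.subspace A \<and> S \<subseteq> A \<and> A \<subseteq> finite_type_star star E"
    if S: "finite S" "S \<subseteq> finite_type_star star E" for S
  proof -
    obtain T x where T: "finite T" "T \<subseteq> E" "x \<in> T" "x \<noteq> 0" "S \<subseteq> star (fract_module.span T)"
      using finite_subset_finite_type_star[OF E S] by auto
    have "star (fract_module.span T) \<subseteq> finite_type_star star E"
      using T finite_type_star_mem_iff[OF nonzero_submodulesD[OF E]] by blast
    then show ?thesis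
      using T star_nonzero_submodule[OF span_nonzero_submodule[OF T(3,4)]]
      by (intro exI[of _ "star (fract_module.span T)"]) (simp add: nonzero_submodulesD)
  qed
  show "fract_module.subspace (finite_type_star star E)"
    unfolding subspace_iff
  proof (intro conjI ballI)
    show "0 \<in> finite_type_star star E"
      using common[of "{}"] by (auto simp: subspace_iff)
    show "x + y \<in> finite_type_star star E"
      if "x \<in> finite_type_star star E" "y \<in> finite_type_star star E" for x y
      using common[of "{x, y}"] that by (auto simp: subspace_iff)
    show "d * x \<in> finite_type_star star E"
      if "d \<in> dom_image" "x \<in> finite_type_star star E" for d x
      using common[of "{x}"] that by (auto simp: subspace_iff)
  qed
qed

lemma finite_type_star_idem:
  assumes E: "E \<in> nonzero_submodules"
  shows "finite_type_star star (finite_type_star star E) = finite_type_star star E"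
proof
  show "finite_type_star star (finite_type_star star E) \<subseteq> finite_type_star star E"
  proof
    fix z assume "z \<in> finite_type_star star (finite_type_star star E)"
    then obtain S y where S: "finite S" "S \<subseteq> finite_type_star star E" "y \<in> S" "y \<noteq> 0"
        "z \<in> star (fract_module.span S)"
      using finite_type_star_mem_iff[OF nonzero_submodulesD[OF
            finite_type_star_nonzero_submodule[OF E]]] by auto
    obtain T x where T: "finite T" "T \<subseteq> E" "x \<in> T" "x \<noteq> 0" "S \<subseteq> star (fract_module.span T)"
      using finite_subset_finite_type_star[OF E S(1,2)] by auto
    note T_nz = span_nonzero_submodule[OF T(3,4)]
    have "star (fract_module.span S) \<subseteq> star (fract_module.span T)"
      by (intro star_subset_star T_nz span_nonzero_submodule[OF S(3,4)]
          fract_module.span_minimal T(5) nonzero_submodulesD star_nonzero_submodule)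
    then show "z \<in> finite_type_star star E"
      using S T finite_type_star_mem_iff[OF nonzero_submodulesD[OF E]] by blast
  qed
next
  show "finite_type_star star E \<subseteq> finite_type_star star (finite_type_star star E)"
    by (intro finite_type_star_extensive finite_type_star_nonzero_submodule E)
qed

lemma finite_type_star_eq_dom_iff:
  assumes J: "nonzero_ideal J"
  shows "finite_type_star star J = finite_type_star star dom_image \<longleftrightarrow>
    1 \<in> finite_type_star star J"
proof
  assume "finite_type_star star J = finite_type_star star dom_image"
  then show "1 \<in> finite_type_star star J"
    using finite_type_star_extensive[OF dom_image_nonzero_submodule] one_in_dom_image by auto
next
  assume one: "1 \<in> finite_type_star star J"
  have J': "J \<in> nonzero_submodules" "J \<subseteq> dom_image"
    using J unfolding nonzero_ideal_def by auto
  have "dom_image \<subseteq> finite_type_star star J"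
    by (rule dom_image_subset[OF nonzero_submodulesD one])
       (rule finite_type_star_nonzero_submodule[OF J'(1)])
  then have "finite_type_star star dom_image \<subseteq> finite_type_star star J"
    using finite_type_star_mono[of dom_image "finite_type_star star J"]
      finite_type_star_idem[OF J'(1)] by simp
  then show "finite_type_star star J = finite_type_star star dom_image"
    using finite_type_star_mono[OF J'(2)] by blast
qed

lemma proper_quasi_ideal_one_notin:
  assumes "quasi_ideal (finite_type_star star) Q" "Q \<noteq> dom_image"
  shows "1 \<notin> finite_type_star star Q"
proof
  assume "1 \<in> finite_type_star star Q"
  then have "1 \<in> Q"
    using assms one_in_dom_image unfolding quasi_ideal_def by blast
  then show False
    using assms dom_image_subset[of Q] nonzero_submodulesD
    unfolding quasi_ideal_def nonzero_ideal_def by blast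
qed

text \<open>
  Finite type is essential here: it makes the condition \<open>1 \<notin> L\<^sup>\<star>\<^sup>f\<close> pass to unions of chains.
  A maximal \<open>Q\<close> with this condition is a quasi-ideal, since \<open>Q\<^sup>\<star>\<^sup>f \<inter> D\<close> satisfies it too.
\<close>

lemma subset_maximal_quasi_ideal:
  assumes J: "nonzero_ideal J" and one: "1 \<notin> finite_type_star star J"
  shows "\<exists>Q\<in>maximal_quasi_ideals (finite_type_star star). J \<subseteq> Q"
proof -
  define A where "A = {L. nonzero_ideal L \<and> J \<subseteq> L \<and> 1 \<notin> finite_type_star star L}"
  have A_D: "fract_module.subspace L" "L \<subseteq> dom_image" "J \<subseteq> L" "1 \<notin> finite_type_star star L"
    if "L \<in> A" for L
    using that nonzero_submodulesD unfolding A_def nonzero_ideal_def by auto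
  have A_I: "L \<in> A" if "fract_module.subspace L" "L \<subseteq> dom_image" "J \<subseteq> L"
    "1 \<notin> finite_type_star star L" for L
    using that subset_submodule_nonzero[of J L] J unfolding A_def nonzero_ideal_def by auto
  have "\<exists>M\<in>A. \<forall>X\<in>A. M \<subseteq> X \<longrightarrow> X = M"
  proof (rule subset_Zorn_nonempty)
    show "A \<noteq> {}"
      using J one unfolding A_def by auto
    fix C assume C: "C \<noteq> {}" "subset.chain A C"
    have CA: "C \<subseteq> A"
      using C(2) unfolding subset.chain_def by simp
    have member: "\<exists>L\<in>C. S \<subseteq> L" if S: "finite S" "S \<subseteq> \<Union>C" for S
      using finite_subset_Union_chain[OF S C] by blast
    have C_sub: "fract_module.subspace L" if "L \<in> C" for L
      using that CA A_D(1) by auto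
    have sub: "fract_module.subspace (\<Union>C)"
      unfolding subspace_iff
    proof (intro conjI ballI)
      show "0 \<in> \<Union>C"
        using C(1) C_sub unfolding subspace_iff by auto
    next
      fix x y assume "x \<in> \<Union>C" "y \<in> \<Union>C"
      then obtain L where L: "L \<in> C" "x \<in> L" "y \<in> L"
        using member[of "{x, y}"] by auto
      then have "x + y \<in> L"
        using C_sub[of L] unfolding subspace_iff by simp
      then show "x + y \<in> \<Union>C"
        using L(1) by auto
    next
      fix d x :: "'a fract" assume d: "d \<in> dom_image" and "x \<in> \<Union>C"
      then obtain L where L: "L \<in> C" "x \<in> L"
        by auto
      then have "d * x \<in> L"
        using d C_sub[of L] unfolding subspace_iff by simp
      then show "d * x \<in> \<Union>C"
        using L(1) by auto
    qed
    show "\<Union>C \<in> A"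
    proof (rule A_I[OF sub])
      show "\<Union>C \<subseteq> dom_image"
        using CA A_D(2) by blast
      show "J \<subseteq> \<Union>C"
        using C(1) CA A_D(3) by blast
      show "1 \<notin> finite_type_star star (\<Union>C)"
      proof
        assume "1 \<in> finite_type_star star (\<Union>C)"
        then obtain S x where S: "finite S" "S \<subseteq> \<Union>C" "x \<in> S" "x \<noteq> 0"
            "1 \<in> star (fract_module.span S)"
          using finite_type_star_mem_iff[OF sub] by auto
        obtain L where L: "L \<in> C" "S \<subseteq> L"
          using member[OF S(1,2)] by auto
        have "1 \<in> finite_type_star star L"
          unfolding finite_type_star_mem_iff[OF C_sub[OF L(1)]]
          by (intro exI[of _ S] exI[of _ x]) (simp add: S L)
        then show False
          using L(1) CA A_D(4) by auto
      qed
    qed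
  qed
  then obtain Q where Q: "Q \<in> A" and max: "\<And>X. X \<in> A \<Longrightarrow> Q \<subseteq> X \<Longrightarrow> X = Q"
    by blast
  have Q_nz: "nonzero_ideal Q" "Q \<in> nonzero_submodules"
    using Q unfolding A_def nonzero_ideal_def by auto
  let ?L = "finite_type_star star Q \<inter> dom_image"
  have "Q \<subseteq> ?L"
    using finite_type_star_extensive[OF Q_nz(2)] A_D(2)[OF Q] by blast
  moreover have "?L \<in> A"
  proof (rule A_I)
    show "fract_module.subspace ?L"
      by (intro fract_module.subspace_inter subspace_dom_image nonzero_submodulesD
          finite_type_star_nonzero_submodule Q_nz)
    show "J \<subseteq> ?L"
      using A_D(3)[OF Q] \<open>Q \<subseteq> ?L\<close> by blast
    show "1 \<notin> finite_type_star star ?L"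
      using finite_type_star_mono[of ?L "finite_type_star star Q"] A_D(4)[OF Q]
        finite_type_star_idem[OF Q_nz(2)] by auto
  qed simp
  ultimately have "?L = Q"
    using max by blast
  then have "quasi_ideal (finite_type_star star) Q"
    using Q_nz unfolding quasi_ideal_def by simp
  moreover have "Q \<noteq> dom_image"
    using A_D(4)[OF Q] finite_type_star_extensive[OF Q_nz(2)] one_in_dom_image by auto
  moreover have "X = Q"
    if "quasi_ideal (finite_type_star star) X" "X \<noteq> dom_image" "Q \<subseteq> X" for X
  proof -
    have "X \<in> A"
      using that A_D(3)[OF Q] proper_quasi_ideal_one_notin[OF that(1,2)]
      unfolding A_def quasi_ideal_def by auto
    then show ?thesis
      using max that(3) by blast
  qed
  ultimately show ?thesis
    using A_D(3)[OF Q] unfolding maximal_quasi_ideals_def by blast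
qed

text \<open>
  If \<open>a b \<in> Q\<close> and \<open>a \<notin> Q\<close>, then maximality gives \<open>1 \<in> (Q + a D)\<^sup>\<star>\<^sup>f\<close>. Multiplication by \<open>b\<close>
  maps \<open>Q + a D\<close> into \<open>Q\<close>, whence \<open>b \<in> Q\<^sup>\<star>\<^sup>f \<inter> D = Q\<close>.
\<close>

lemma maximal_quasi_ideal_prime:
  assumes Q: "Q \<in> maximal_quasi_ideals (finite_type_star star)"
    and a: "a \<in> dom_image" and b: "b \<in> dom_image" and ab: "a * b \<in> Q"
  shows "a \<in> Q \<or> b \<in> Q"
proof (rule ccontr)
  assume neg: "\<not> (a \<in> Q \<or> b \<in> Q)"
  have quasi: "quasi_ideal (finite_type_star star) Q"
    and Q_nz: "Q \<in> nonzero_submodules" and Q_sub: "Q \<subseteq> dom_image"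
    using Q unfolding maximal_quasi_ideals_def quasi_ideal_def nonzero_ideal_def by auto
  have Qs: "fract_module.subspace Q"
    using nonzero_submodulesD[OF Q_nz] .
  have "b \<noteq> 0"
    using neg Qs unfolding subspace_iff by auto
  define E where "E = fract_module.span (insert a Q)"
  have Es: "fract_module.subspace E"
    unfolding E_def by (rule fract_module.subspace_span)
  have aE: "a \<in> E" and QE: "Q \<subseteq> E"
    unfolding E_def using fract_module.span_superset by blast+
  have E: "nonzero_ideal E"
    unfolding nonzero_ideal_def
    using subset_submodule_nonzero[OF Q_nz QE Es] a Q_sub
      fract_module.span_minimal[OF _ subspace_dom_image, of "insert a Q"]
    by (auto simp: E_def)
  have "1 \<in> finite_type_star star E"
  proof (rule ccontr)
    assume "1 \<notin> finite_type_star star E"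
    then obtain P where P: "P \<in> maximal_quasi_ideals (finite_type_star star)" "E \<subseteq> P"
      using subset_maximal_quasi_ideal[OF E] by blast
    then have "P = Q"
      using Q QE unfolding maximal_quasi_ideals_def by blast
    then show False
      using P(2) aE neg by blast
  qed
  then obtain S x where S: "finite S" "S \<subseteq> E" "x \<in> S" "x \<noteq> 0" "1 \<in> star (fract_module.span S)"
    using finite_type_star_mem_iff[OF Es] by auto
  have bE: "b * z \<in> Q" if "z \<in> E" for z
  proof -
    have "E \<subseteq> {z. b * z \<in> Q}"
      unfolding E_def
    proof (rule fract_module.span_minimal)
      show "insert a Q \<subseteq> {z. b * z \<in> Q}"
        using ab b Qs unfolding subspace_iff by (auto simp: mult.commute)
      show "fract_module.subspace {z. b * z \<in> Q}"
        using Qs unfolding subspace_iff by (auto simp: distrib_left mult.left_commute)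
    qed
    then show ?thesis
      using that by blast
  qed
  let ?F = "fract_module.span S" and ?G = "fract_module.span ((\<lambda>y. b * y) ` S)"
  have F: "?F \<in> nonzero_submodules"
    using span_nonzero_submodule[OF S(3,4)] .
  have G: "?G \<in> nonzero_submodules"
    by (rule span_nonzero_submodule[of "b * x"]) (use S \<open>b \<noteq> 0\<close> in auto)
  have bF: "(\<lambda>y. b * y) ` ?F \<subseteq> ?G"
  proof -
    have "?F \<subseteq> {z. b * z \<in> ?G}"
    proof (rule fract_module.span_minimal)
      show "S \<subseteq> {z. b * z \<in> ?G}"
        by (auto intro: fract_module.span_base)
      show "fract_module.subspace {z. b * z \<in> ?G}"
        using fract_module.subspace_span[of "(\<lambda>y. b * y) ` S"] unfolding subspace_iff
        by (auto simp: distrib_left mult.left_commute)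
    qed
    then show ?thesis
      by blast
  qed
  have bF_nz: "(\<lambda>y. b * y) ` ?F \<in> nonzero_submodules"
  proof (rule nonzero_submodulesI)
    have "fract_module.subspace ?F"
      by (rule fract_module.subspace_span)
    then show "fract_module.subspace ((\<lambda>y. b * y) ` ?F)"
      unfolding subspace_iff
      by (auto simp: image_iff distrib_left[symmetric] mult.left_commute[of _ b])
    show "b * x \<in> (\<lambda>y. b * y) ` ?F"
      using S(3) fract_module.span_base by blast
    show "b * x \<noteq> 0"
      using \<open>b \<noteq> 0\<close> S(4) by simp
  qed
  have "b \<in> (\<lambda>y. b * y) ` star ?F"
    using S(5) by (auto simp: image_iff intro: bexI[of _ 1])
  then have "b \<in> star ?G"
    using star_mono[OF bF_nz G bF] star_scale[OF F \<open>b \<noteq> 0\<close>] by auto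
  then have "b \<in> finite_type_star star Q"
    unfolding finite_type_star_mem_iff[OF Qs]
    by (intro exI[of _ "(\<lambda>y. b * y) ` S"] exI[of _ "b * x"]) (use S bE \<open>b \<noteq> 0\<close> in auto)
  then have "b \<in> Q"
    using b quasi unfolding quasi_ideal_def by blast
  then show False
    using neg by blast
qed

lemma one_in_finite_type_star_iff:
  assumes J: "nonzero_ideal J"
  shows "1 \<in> finite_type_star star J \<longleftrightarrow>
    (\<forall>Q\<in>maximal_quasi_ideals (finite_type_star star). \<not> J \<subseteq> Q)"
proof
  assume one: "1 \<in> finite_type_star star J"
  show "\<forall>Q\<in>maximal_quasi_ideals (finite_type_star star). \<not> J \<subseteq> Q"
  proof (intro ballI notI)
    fix Q assume "Q \<in> maximal_quasi_ideals (finite_type_star star)" "J \<subseteq> Q"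
    then show False
      using proper_quasi_ideal_one_notin[of Q] finite_type_star_mono[of J Q] one
      unfolding maximal_quasi_ideals_def by blast
  qed
next
  assume "\<forall>Q\<in>maximal_quasi_ideals (finite_type_star star). \<not> J \<subseteq> Q"
  then show "1 \<in> finite_type_star star J"
    using subset_maximal_quasi_ideal[OF J] by blast
qed

end

section \<open>Localization at a prime ideal\<close>

text \<open>
  Sums of fractions are brought over a common denominator, which lies outside \<open>Q\<close> because \<open>Q\<close>
  is prime.
\<close>

lemma submodule_prod_localization:
  fixes E Q :: "'a :: idom fract set"
  assumes Q: "0 \<in> Q" "1 \<notin> Q"
    and prime: "\<And>a b. a \<in> dom_image \<Longrightarrow> b \<in> dom_image \<Longrightarrow> a * b \<in> Q \<Longrightarrow> a \<in> Q \<or> b \<in> Q"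
    and E: "fract_module.subspace E"
  shows "submodule_prod E (localization_at Q) = {x / s | x s. x \<in> E \<and> s \<in> dom_image \<and> s \<notin> Q}"
    (is "?P = ?R")
proof
  have E_mult: "d * x \<in> E" if "d \<in> dom_image" "x \<in> E" for d x
    using E that unfolding subspace_iff by blast
  have R: "fract_module.subspace ?R"
    unfolding subspace_iff
  proof (intro conjI ballI)
    show "0 \<in> ?R"
      using E Q(2) one_in_dom_image unfolding subspace_iff by force
  next
    fix u v assume "u \<in> ?R" "v \<in> ?R"
    then obtain x s y t where u: "u = x / s" "x \<in> E" "s \<in> dom_image" "s \<notin> Q"
      and v: "v = y / t" "y \<in> E" "t \<in> dom_image" "t \<notin> Q"
      by blast
    have "s \<noteq> 0" "t \<noteq> 0"
      using Q(1) u v by auto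
    then have "u + v = (t * x + s * y) / (s * t)"
      using u v by (simp add: field_simps)
    moreover have "t * x + s * y \<in> E"
      using E E_mult u v unfolding subspace_iff by blast
    moreover have "s * t \<in> dom_image" "s * t \<notin> Q"
      using u v prime dom_image_mult by blast+
    ultimately show "u + v \<in> ?R"
      by blast
  next
    fix d u :: "'a fract" assume d: "d \<in> dom_image" and "u \<in> ?R"
    then obtain x s where "u = x / s" "x \<in> E" "s \<in> dom_image" "s \<notin> Q"
      by blast
    then have "d * u = (d * x) / s" "d * x \<in> E" "s \<in> dom_image" "s \<notin> Q"
      using E_mult[OF d] by auto
    then show "d * u \<in> ?R"
      by blast
  qed
  show "?P \<subseteq> ?R"
    unfolding submodule_prod_def
  proof (rule fract_module.span_minimal[OF _ R], clarify)
    fix x y assume x: "x \<in> E" and "y \<in> localization_at Q"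
    then obtain a s where "y = a / s" "a \<in> dom_image" "s \<in> dom_image" "s \<notin> Q"
      unfolding localization_at_def by blast
    then have "x * y = (a * x) / s" "a * x \<in> E" "s \<in> dom_image" "s \<notin> Q"
      using E_mult x by (auto simp: mult.commute)
    then show "\<exists>x' s. x * y = x' / s \<and> x' \<in> E \<and> s \<in> dom_image \<and> s \<notin> Q"
      by blast
  qed
  show "?R \<subseteq> ?P"
  proof
    fix u assume "u \<in> ?R"
    then obtain x s where u: "u = x * (1 / s)" "x \<in> E" "s \<in> dom_image" "s \<notin> Q"
      by auto
    then have "1 / s \<in> localization_at Q"
      using one_in_dom_image unfolding localization_at_def by blast
    then have "u \<in> {x * y | x y. x \<in> E \<and> y \<in> localization_at Q}"
      using u(1,2) by blast
    then show "u \<in> ?P"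
      unfolding submodule_prod_def by (rule fract_module.span_base)
  qed
qed

text \<open>
  If \<open>J \<subseteq> Q\<close>, then \<open>1 = x / s\<close> with \<open>x \<in> J\<close> would put the denominator \<open>s = x\<close> into \<open>Q\<close>.
  On the other hand, for \<open>s \<in> J - Q\<close>, every fraction \<open>x / t\<close> can be expanded to \<open>s x / (s t)\<close>, which has its
  numerator in \<open>J\<close>.
\<close>

lemma tilde_star_eq_dom_iff:
  fixes star :: "'a :: idom fract set \<Rightarrow> 'a fract set"
  assumes star: "semistar_operation star" and J: "nonzero_ideal J"
  shows "tilde_star star J = tilde_star star dom_image \<longleftrightarrow>
    (\<forall>Q\<in>maximal_quasi_ideals (finite_type_star star). \<not> J \<subseteq> Q)"
proof -
  let ?M = "maximal_quasi_ideals (finite_type_star star)"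
  have Js: "fract_module.subspace J" and JD: "J \<subseteq> dom_image"
    using J nonzero_submodulesD unfolding nonzero_ideal_def by auto
  have M_D: "fract_module.subspace Q" "0 \<in> Q" "1 \<notin> Q" if Q: "Q \<in> ?M" for Q
  proof -
    have ne: "Q \<noteq> dom_image" and sub: "Q \<subseteq> dom_image" and nz: "Q \<in> nonzero_submodules"
      using Q unfolding maximal_quasi_ideals_def quasi_ideal_def nonzero_ideal_def by auto
    show Qs: "fract_module.subspace Q"
      using nonzero_submodulesD[OF nz] .
    then show "0 \<in> Q"
      unfolding subspace_iff by simp
    show "1 \<notin> Q"
      using dom_image_subset[OF Qs] ne sub by auto
  qed
  have loc: "submodule_prod E (localization_at Q) =
      {x / s | x s. x \<in> E \<and> s \<in> dom_image \<and> s \<notin> Q}"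
    if Q: "Q \<in> ?M" and E: "fract_module.subspace E" for E Q
    by (rule submodule_prod_localization[OF M_D(2,3)[OF Q] maximal_quasi_ideal_prime[OF star Q] E])
  show ?thesis
  proof
    assume eq: "tilde_star star J = tilde_star star dom_image"
    show "\<forall>Q\<in>?M. \<not> J \<subseteq> Q"
    proof (intro ballI notI)
      fix Q assume Q: "Q \<in> ?M" and JQ: "J \<subseteq> Q"
      have "1 \<in> submodule_prod dom_image (localization_at P)" if P: "P \<in> ?M" for P
      proof -
        have "(1 :: 'a fract) = 1 / 1"
          by simp
        then show ?thesis
          unfolding loc[OF P subspace_dom_image]
          using M_D(3)[OF P] one_in_dom_image by blast
      qed
      then have "1 \<in> tilde_star star J"
        unfolding eq unfolding tilde_star_def by blast
      then have "1 \<in> submodule_prod J (localization_at Q)"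
        using Q unfolding tilde_star_def by blast
      then obtain x s where "1 = x / s" "x \<in> J" "s \<notin> Q"
        unfolding loc[OF Q Js] by blast
      moreover from this have "x = s"
        by (cases "s = 0") (simp_all add: field_simps)
      ultimately show False
        using JQ by blast
    qed
  next
    assume nsub: "\<forall>Q\<in>?M. \<not> J \<subseteq> Q"
    have "submodule_prod J (localization_at Q) = submodule_prod dom_image (localization_at Q)"
      if Q: "Q \<in> ?M" for Q
    proof
      show "submodule_prod J (localization_at Q) \<subseteq> submodule_prod dom_image (localization_at Q)"
        unfolding loc[OF Q Js] loc[OF Q subspace_dom_image] using JD by blast
      obtain s where s: "s \<in> J" "s \<notin> Q"
        using nsub Q by blast
      have "s \<noteq> 0"
        using s(2) M_D(2)[OF Q] by auto
      show "submodule_prod dom_image (localization_at Q) \<subseteq> submodule_prod J (localization_at Q)"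
      proof
        fix u assume "u \<in> submodule_prod dom_image (localization_at Q)"
        then obtain x t where u: "u = x / t" "x \<in> dom_image" "t \<in> dom_image" "t \<notin> Q"
          unfolding loc[OF Q subspace_dom_image] by blast
        have "u = (x * s) / (t * s)"
          using u(1) \<open>s \<noteq> 0\<close> by simp
        moreover have "x * s \<in> J"
          using u(2) s(1) Js unfolding subspace_iff by simp
        moreover have sD: "s \<in> dom_image"
          using s(1) JD by auto
        then have "t * s \<in> dom_image"
          by (rule dom_image_mult[OF u(3)])
        moreover have "t * s \<notin> Q"
          using maximal_quasi_ideal_prime[OF star Q u(3) sD] u(4) s(2) by auto
        ultimately show "u \<in> submodule_prod J (localization_at Q)"
          unfolding loc[OF Q Js] by blast
      qed
    qed
    then show "tilde_star star J = tilde_star star dom_image"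
      unfolding tilde_star_def by simp
  qed
qed

section \<open>Invertibility\<close>

theorem proposition2p18:
  fixes star :: "'a :: idom fract set \<Rightarrow> 'a fract set"
    and I :: "'a fract set"
  assumes "semistar_operation star"
    and "nonzero_fractional_ideal I"
  shows "star_invertible (finite_type_star star) I \<longleftrightarrow> star_invertible (tilde_star star) I"
  using submodule_prod_inv_nonzero_ideal[OF assms(2)]
  by (simp add: star_invertible_def finite_type_star_eq_dom_iff[OF assms(1)]
      one_in_finite_type_star_iff[OF assms(1)] tilde_star_eq_dom_iff[OF assms(1)])

end
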